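(* Let $n_r\ge 1$ be the number of relations and consider LowFER models with $d_r=n_r$ and relation embedding matrix equal to the identity $\mathbf{I}_{n_r}$, so that the embedding of the $l$-th relation is the $l$-th standard basis vector of $\mathbb{R}^{n_r}$. Write $f(\mathbf{x},l,\mathbf{y})$ for the LowFER score of a subject vector $\mathbf{x}$, the $l$-th relation and an object vector $\mathbf{y}$. Then LowFER encodes each of the following models. (1) RESCAL. Let $k=d_e$ and $\mathbf{U}=[\,\mathbf{I}_{d_e}\,|\,\cdots\,|\,\mathbf{I}_{d_e}\,]\in\mathbb{R}^{d_e\times d_e^2}$ ($d_e$ identity blocks). For all $\mathbf{W}_1,\dots,\mathbf{W}_{n_r}\in\mathbb{R}^{d_e\times d_e}$ there is $\mathbf{V}\in\mathbb{R}^{n_r\times d_e^2}$ (whose $l$-th row, reshaped row by row to a $d_e\times d_e$ matrix and transposed, is $\mathbf{W}_l$) such that $f(\mathbf{e}_s,l,\mathbf{e}_o)=\mathbf{e}_s^T\mathbf{W}_l\mathbf{e}_o$ for all $\mathbf{e}_s,\mathbf{e}_o\in\mathbb{R}^{d_e}$ and all $l$. (2) DistMult. Let $k=1$ and $\mathbf{U}=\mathbf{I}_{d_e}$. For all $\mathbf{w}_1,\dots,\mathbf{w}_{n_r}\in\mathbb{R}^{d_e}$, if $\mathbf{V}\in\mathbb{R}^{n_r\times d_e}$ has $l$-th row $\mathbf{w}_l$, then $f(\mathbf{e}_s,l,\mathbf{e}_o)=\mathbf{e}_s^T\mathrm{diag}(\mathbf{w}_l)\mathbf{e}_o$ for all $\mathbf{e}_s,\mathbf{e}_o\in\mathbb{R}^{d_e}$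 and all $l$. (3) SimplE. Let $k=1$, $d_e=2d$, and $\mathbf{U}=\begin{bmatrix}0&\tfrac12\mathbf{I}_d\\\tfrac12\mathbf{I}_d&0\end{bmatrix}$. For all $\mathbf{r}_l,\mathbf{r}_l^{-1}\in\mathbb{R}^d$ ($l=1,\dots,n_r$), if $\mathbf{V}\in\mathbb{R}^{n_r\times 2d}$ has $l$-th row $[\mathbf{r}_l^{-1};\mathbf{r}_l]$, then for all $\mathbf{h}_{e_s},\mathbf{t}_{e_s},\mathbf{h}_{e_o},\mathbf{t}_{e_o}\in\mathbb{R}^d$ and all $l$, $$f([\mathbf{h}_{e_s};\mathbf{t}_{e_s}],l,[\mathbf{h}_{e_o};\mathbf{t}_{e_o}])=\tfrac12\bigl(\mathbf{h}_{e_s}^T\mathrm{diag}(\mathbf{r}_l)\mathbf{t}_{e_o}+\mathbf{h}_{e_o}^T\mathrm{diag}(\mathbf{r}_l^{-1})\mathbf{t}_{e_s}\bigr).$$ (4) ComplEx. Let $k=2$, $d_e=2d$, and let $\mathbf{U}\in\mathbb{R}^{2d\times4d}$ be the matrix whose slices are $\mathbf{W}_U^{(1)}=\begin{bmatrix}\mathbf{I}_d&\mathbf{I}_d\\0&0\end{bmatrix}$ and $\mathbf{W}_U^{(2)}=\begin{bmatrix}0&0\\-\mathbf{I}_d&\mathbf{I}_d\end{bmatrix}$. For all $\mathbf{r}_1,\dots,\mathbf{r}_{n_r}\in\mathbb{C}^d$, if $\mathbf{V}\in\mathbb{R}^{n_r\times4d}$ is the matrix whose slices $\mathbf{W}_V^{(1)},\mathbf{W}_V^{(2)}\in\mathbb{R}^{n_r\times2d}$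 have $l$-th rows $[\mathrm{Re}(\mathbf{r}_l);\mathrm{Im}(\mathbf{r}_l)]$ and $[\mathrm{Im}(\mathbf{r}_l);\mathrm{Re}(\mathbf{r}_l)]$ respectively, then for all $\mathbf{e}_s,\mathbf{e}_o\in\mathbb{C}^d$ and all $l$, $$\begin{aligned}f([\mathrm{Re}(\mathbf{e}_s);\mathrm{Im}(\mathbf{e}_s)],l,[\mathrm{Re}(\mathbf{e}_o);\mathrm{Im}(\mathbf{e}_o)])={}&\mathrm{Re}(\mathbf{e}_s)^T\mathrm{diag}(\mathrm{Re}(\mathbf{r}_l))\mathrm{Re}(\mathbf{e}_o)+\mathrm{Im}(\mathbf{e}_s)^T\mathrm{diag}(\mathrm{Re}(\mathbf{r}_l))\mathrm{Im}(\mathbf{e}_o)\\&+\mathrm{Re}(\mathbf{e}_s)^T\mathrm{diag}(\mathrm{Im}(\mathbf{r}_l))\mathrm{Im}(\mathbf{e}_o)-\mathrm{Im}(\mathbf{e}_s)^T\mathrm{diag}(\mathrm{Im}(\mathbf{r}_l))\mathrm{Re}(\mathbf{e}_o).\end{aligned}$$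
   Context: LowFER model. With entity embedding dimension $d_e$, relation embedding dimension $d_r$, factorization rank $k\ge1$ and parameters $\mathbf{U}\in\mathbb{R}^{d_e\times kd_e}$, $\mathbf{V}\in\mathbb{R}^{d_r\times kd_e}$, the LowFER score of a subject vector $\mathbf{e}_s\in\mathbb{R}^{d_e}$, relation vector $\mathbf{r}\in\mathbb{R}^{d_r}$ and object vector $\mathbf{e}_o\in\mathbb{R}^{d_e}$ is $\bigl(\mathbf{S}^k\,\mathrm{diag}(\mathbf{U}^T\mathbf{e}_s)\,\mathbf{V}^T\mathbf{r}\bigr)^T\mathbf{e}_o$, where $\mathbf{S}^k\in\mathbb{R}^{d_e\times kd_e}$ has $\mathbf{S}^k_{i,j}=1$ if $(i-1)k+1\le j\le ik$ and $0$ otherwise. Slices. If $\mathbf{u}_1,\dots,\mathbf{u}_{kd_e}$ are the columns of $\mathbf{U}$, then for $1\le i\le k$ the $i$-th slice is $\mathbf{W}_U^{(i)}=[\mathbf{u}_i,\mathbf{u}_{k+i},\dots,\mathbf{u}_{k(d_e-1)+i}]\in\mathbb{R}^{d_e\times d_e}$; $\mathbf{W}_V^{(i)}\in\mathbb{R}^{d_r\times d_e}$ is defined in the same way from the columns of $\mathbf{V}$. The slices determine $\mathbf{U}$ and $\mathbf{V}$. $[\mathbf{x};\mathbf{y}]$ denotes concatenation of vectors. In SimplE, $\mathbf{h}_e,\mathbf{t}_e\in\mathbb{R}^d$ are the head and tail vectors of an entity $e$, and $\mathbf{r}_l$, $\mathbf{r}_l^{-1}$ are two independent vectors attached to the $l$-th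 relation and its inverse ($\mathbf{r}_l^{-1}$ is just notation, not an inverse). *)

theory Defs
  imports Complex_Main "Jordan_Normal_Form.Matrix"
begin

text \<open>All indices (rows, columns, slices, relations) are 0-based.\<close>

definition diag_of_vec :: "real vec \<Rightarrow> real mat" where
  "diag_of_vec v = mat_diag (dim_vec v) (\<lambda>i. v $ i)"

definition S_mat :: "nat \<Rightarrow> nat \<Rightarrow> real mat" where
  "S_mat d\<^sub>e k = mat d\<^sub>e (k * d\<^sub>e) (\<lambda>(i, j). if i * k \<le> j \<and> j < (i + 1) * k then 1 else 0)"

definition lowfer_score ::
  "nat \<Rightarrow> nat \<Rightarrow> real mat \<Rightarrow> real mat \<Rightarrow> real vec \<Rightarrow> real vec \<Rightarrow> real vec \<Rightarrow> real" where
  "lowfer_score d\<^sub>e k U V e\<^sub>s r e\<^sub>o =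
     ((S_mat d\<^sub>e k * diag_of_vec (transpose_mat U *\<^sub>v e\<^sub>s) * transpose_mat V) *\<^sub>v r) \<bullet> e\<^sub>o"

text \<open>Row \<open>l\<close> of the relation embedding matrix \<open>R\<close> is the embedding of the \<open>l\<close>-th relation.\<close>

definition lowfer_rel_score ::
  "nat \<Rightarrow> nat \<Rightarrow> real mat \<Rightarrow> real mat \<Rightarrow> real mat \<Rightarrow> real vec \<Rightarrow> nat \<Rightarrow> real vec \<Rightarrow> real" where
  "lowfer_rel_score d\<^sub>e k R U V x l y = lowfer_score d\<^sub>e k U V x (row R l) y"

text \<open>For \<open>i < k\<close> and \<open>M\<close> with \<open>k * d\<close> columns; \<open>slice d k i M\<close> is the slice
  conventionally numbered \<open>i + 1\<close>.\<close>

definition slice :: "nat \<Rightarrow> nat \<Rightarrow> nat \<Rightarrow> real mat \<Rightarrow> real mat" where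
  "slice d k i M = mat_of_cols (dim_row M) (map (\<lambda>j. col M (k * j + i)) [0..<d])"

definition repeated_id_mat :: "nat \<Rightarrow> nat \<Rightarrow> real mat" where
  "repeated_id_mat d k = mat d (k * d) (\<lambda>(i, j). 1\<^sub>m d $$ (i, j mod d))"

definition reshape_rows :: "nat \<Rightarrow> real vec \<Rightarrow> real mat" where
  "reshape_rows d v = mat d d (\<lambda>(i, j). v $ (i * d + j))"

text \<open>A matrix may be specified by prescribing its slices.\<close>

lemma ex1_mat_of_slices:
  assumes W: "\<And>i. i < k \<Longrightarrow> W i \<in> carrier_mat m d"
  shows "\<exists>!M. M \<in> carrier_mat m (k * d) \<and> (\<forall>i<k. slice d k i M = W i)"
proof -
  have idx: "k * j + i < k * d" if "i < k" "j < d" for i j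
  proof -
    have "k * j + i < k * Suc j" using that by simp
    also have "\<dots> \<le> k * d" using that by (intro mult_le_mono) auto
    finally show ?thesis .
  qed
  have ent: "slice d k i M $$ (a, j) = M $$ (a, k * j + i)"
    if "M \<in> carrier_mat m (k * d)" "i < k" "a < m" "j < d" for M i a j
    using that idx[of i j] by (auto simp: slice_def mat_of_cols_index)
  show ?thesis
  proof (rule ex1I)
    let ?M = "mat m (k * d) (\<lambda>(a, j). W (j mod k) $$ (a, j div k))"
    show "?M \<in> carrier_mat m (k * d) \<and> (\<forall>i<k. slice d k i ?M = W i)"
    proof (intro conjI allI impI)
      fix i assume i: "i < k"
      show "slice d k i ?M = W i"
      proof (rule eq_matI)
        fix a j assume "a < dim_row (W i)" "j < dim_col (W i)"
        then have aj: "a < m" "j < d" using W[OF i] by auto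
        then show "slice d k i ?M $$ (a, j) = W i $$ (a, j)"
          using i idx[OF i aj(2)] by (subst ent) auto
      qed (use W[OF i] in \<open>auto simp: slice_def\<close>)
    qed auto
  next
    fix M assume M: "M \<in> carrier_mat m (k * d) \<and> (\<forall>i<k. slice d k i M = W i)"
    show "M = mat m (k * d) (\<lambda>(a, j). W (j mod k) $$ (a, j div k))"
    proof (rule eq_matI)
      fix a j
      assume "a < dim_row (mat m (k * d) (\<lambda>(a, j). W (j mod k) $$ (a, j div k)))"
        and "j < dim_col (mat m (k * d) (\<lambda>(a, j). W (j mod k) $$ (a, j div k)))"
      then have aj: "a < m" "j < k * d" by auto
      then have k: "k > 0" by (cases k) auto
      have "j div k < d" using aj by (simp add: less_mult_imp_div_less mult.commute)
      then have "slice d k (j mod k) M $$ (a, j div k) = M $$ (a, j)"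
        using ent[of M "j mod k" a "j div k"] M aj k by simp
      then show "M $$ (a, j) = mat m (k * d) (\<lambda>(a, j). W (j mod k) $$ (a, j div k)) $$ (a, j)"
        using M aj k by simp
    qed (use M in auto)
  qed
qed

end

(*
  Cutting the column index set of U and V into residue classes modulo k turns the LowFER score into
  a sum of k diagonal trilinear forms, one for each pair of slices of U and V.  Each of the four
  models is then read off from its slices.
*)
theory Submission
  imports Defs
begin

section \<open>Diagonal matrices and the trilinear form they define\<close>

lemma dim_diag_of_vec [simp]:
  "dim_row (diag_of_vec v) = dim_vec v" "dim_col (diag_of_vec v) = dim_vec v"
  by (simp_all add: diag_of_vec_def mat_diag_def)

lemma index_diag_mult_vec:
  assumes "i < dim_vec w" "dim_vec v = dim_vec w"
  shows "(diag_of_vec w *\<^sub>v v) $ i = w $ i * v $ i"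
proof -
  \<comment> \<open>Off the diagonal row i vanishes, so the scalar product is a sum supported at j =
    i.\<close>
  have "(diag_of_vec w *\<^sub>v v) $ i = (\<Sum>j<dim_vec w. (if j = i then w $ i * v $ i else 0))"
    using assms by (auto simp: diag_of_vec_def scalar_prod_def mat_diag_def
        lessThan_atLeast0 simp del: sum.delta sum.delta' intro!: sum.cong)
  then show ?thesis
    using assms by simp
qed

lemma scalar_prod_diag:
  assumes "x \<in> carrier_vec n" "w \<in> carrier_vec n" "y \<in> carrier_vec n"
  shows "x \<bullet> (diag_of_vec w *\<^sub>v y) = (\<Sum>i<n. x $ i * w $ i * y $ i)"
proof -
  have "x \<bullet> (diag_of_vec w *\<^sub>v y) = (\<Sum>i<n. x $ i * (diag_of_vec w *\<^sub>v y) $ i)"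
    using assms by (simp add: scalar_prod_def lessThan_atLeast0)
  also have "\<dots> = (\<Sum>i<n. x $ i * w $ i * y $ i)"
    using assms by (intro sum.cong) (auto simp: index_diag_mult_vec simp del: index_mult_mat_vec)
  finally show ?thesis .
qed

text \<open>The outer vectors enter the coordinate sum symmetrically. SimplE relies on this: its
  inverse term names the object first, whereas the score produces the subject first.\<close>

lemma scalar_prod_diag_commute:
  assumes "x \<in> carrier_vec n" "w \<in> carrier_vec n" "y \<in> carrier_vec n"
  shows "x \<bullet> (diag_of_vec w *\<^sub>v y) = y \<bullet> (diag_of_vec w *\<^sub>v x)"
  using assms by (simp add: scalar_prod_diag mult_ac)

text \<open>A diagonal matrix never mixes coordinates, so the form splits along a concatenation.
  SimplE and ComplEx need this for embeddings made of two halves of length d.\<close>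

lemma scalar_prod_diag_append:
  assumes "x \<in> carrier_vec n" "w \<in> carrier_vec n" "y \<in> carrier_vec n"
    and "x' \<in> carrier_vec m" "w' \<in> carrier_vec m" "y' \<in> carrier_vec m"
  shows "(x @\<^sub>v x') \<bullet> (diag_of_vec (w @\<^sub>v w') *\<^sub>v (y @\<^sub>v y'))
    = x \<bullet> (diag_of_vec w *\<^sub>v y) + x' \<bullet> (diag_of_vec w' *\<^sub>v y')"
proof -
  have "diag_of_vec (w @\<^sub>v w') *\<^sub>v (y @\<^sub>v y') = (diag_of_vec w *\<^sub>v y) @\<^sub>v (diag_of_vec w' *\<^sub>v y')"
    using assms
    by (intro eq_vecI) (auto simp: index_diag_mult_vec simp del: index_mult_mat_vec)
  moreover have "diag_of_vec w *\<^sub>v y \<in> carrier_vec n" "diag_of_vec w' *\<^sub>v y' \<in> carrier_vec m"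
    using assms by (auto intro!: carrier_vecI)
  ultimately show ?thesis
    using assms by (simp add: scalar_prod_append)
qed

lemma zero_mult_vec: "v \<in> carrier_vec n \<Longrightarrow> 0\<^sub>m m n *\<^sub>v v = 0\<^sub>v m"
  by (intro eq_vecI) auto

section \<open>Slices and the block-summing matrix S^k\<close>

lemma slice_index_less:
  fixes i j k d :: nat
  assumes "i < k" "j < d"
  shows "k * j + i < k * d"
proof -
  have "k * j + i < k * Suc j" using assms by simp
  also have "\<dots> \<le> k * d" using assms by (intro mult_le_mono) auto
  finally show ?thesis .
qed

lemma dim_slice [simp]:
  "dim_row (slice d k j M) = dim_row M" "dim_col (slice d k j M) = d"
  by (simp_all add: slice_def)

lemma col_slice:
  assumes "i < d"
  shows "col (slice d k j M) i = col M (k * i + j)"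
  using assms by (auto simp: slice_def intro!: col_mat_of_cols carrier_vecI)

lemma index_slice:
  assumes "M \<in> carrier_mat m (k * d)" "l < m" "i < d" "j < k"
  shows "slice d k j M $$ (l, i) = M $$ (l, k * i + j)"
  using assms slice_index_less[of j k i d] by (auto simp: slice_def mat_of_cols_index)

lemma slice_1: "M \<in> carrier_mat m d \<Longrightarrow> slice d 1 0 M = M"
  by (rule eq_matI) (auto simp: slice_def mat_of_cols_index)

text \<open>Row i of S^k is the indicator of the i-th block of k consecutive positions. Indexing
  that block by its offset j is what later matches the numbering of the slices.\<close>

lemma index_S_mat_mult_vec:
  assumes v: "v \<in> carrier_vec (k * d)" and i: "i < d"
  shows "(S_mat d k *\<^sub>v v) $ i = (\<Sum>j<k. v $ (k * i + j))"
proof -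
  let ?B = "{k * i..<k * i + k}"
  \<comment> \<open>The block ends before k * (i + 1), which is at most k * d because i < d; hence
    the summation range cuts nothing off.\<close>
  have B: "?B \<subseteq> {0..<k * d}"
    using slice_index_less[of _ k i d] i
    by (metis add.commute atLeast0LessThan ivl_subset le0 mult_Suc_right mult_le_mono2 Suc_leI)
  have "(S_mat d k *\<^sub>v v) $ i = (\<Sum>p = 0..<k * d. if p \<in> ?B then v $ p else 0)"
    using v i by (auto simp: S_mat_def scalar_prod_def mult.commute intro!: sum.cong)
  also have "\<dots> = sum (($) v) ?B"
    using B by (simp only: sum.inter_restrict[symmetric] finite_atLeastLessThan Int_absorb1)
  also have "\<dots> = (\<Sum>j<k. v $ (k * i + j))"
    using sum.shift_bounds_nat_ivl[of "($) v" 0 "k * i" k]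
    by (simp add: lessThan_atLeast0 add.commute)
  finally show ?thesis .
qed

section \<open>The score as a sum over slices\<close>

text \<open>Coordinate i of the score vector sums the coordinatewise product of U^T x and row l of V
  over the positions k * i + j with j < k. Column i of slice j is column k * i + j of the full
  matrix, so fixing j and varying i stays within one pair of slices.\<close>

lemma lowfer_rel_score_slices:
  assumes U: "U \<in> carrier_mat d (k * d)" and V: "V \<in> carrier_mat n (k * d)"
    and x: "x \<in> carrier_vec d" and y: "y \<in> carrier_vec d" and l: "l < n"
  shows "lowfer_rel_score d k (1\<^sub>m n) U V x l y
    = (\<Sum>j<k. (transpose_mat (slice d k j U) *\<^sub>v x) \<bullet> (diag_of_vec (row (slice d k j V) l) *\<^sub>v y))"
proof -
  let ?u = "transpose_mat U *\<^sub>v x"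
  let ?D = "diag_of_vec ?u"
  have u: "?u \<in> carrier_vec (k * d)" and D: "?D \<in> carrier_mat (k * d) (k * d)"
    using U by (auto intro!: carrier_vecI)
  have S: "S_mat d k \<in> carrier_mat d (k * d)"
    by (simp add: S_mat_def)
  have VT: "transpose_mat V \<in> carrier_mat (k * d) n"
    using V by simp
  \<comment> \<open>The identity relation matrix makes the l-th embedding a unit vector, which
    selects row l of V.\<close>
  have Vl: "transpose_mat V *\<^sub>v unit_vec n l = row V l"
    using V l by (intro eq_vecI) auto
  have row_V: "row V l \<in> carrier_vec (k * d)"
    using V l by auto
  have Dv: "?D *\<^sub>v row V l \<in> carrier_vec (k * d)"
    using D by (auto intro!: carrier_vecI)
  have "(S_mat d k * ?D * transpose_mat V) *\<^sub>v unit_vec n l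
      = S_mat d k *\<^sub>v (?D *\<^sub>v row V l)"
    using assoc_mult_mat_vec[OF mult_carrier_mat[OF S D] VT, of "unit_vec n l"]
      assoc_mult_mat_vec[OF S D row_V] Vl by simp
  then have "lowfer_rel_score d k (1\<^sub>m n) U V x l y = (S_mat d k *\<^sub>v (?D *\<^sub>v row V l)) \<bullet> y"
    using l by (simp add: lowfer_rel_score_def lowfer_score_def)
  also have "\<dots> = (\<Sum>i<d. (\<Sum>j<k. (?D *\<^sub>v row V l) $ (k * i + j)) * y $ i)"
    unfolding scalar_prod_def lessThan_atLeast0[symmetric]
    using y Dv by (intro sum.cong) (auto simp: index_S_mat_mult_vec simp del: index_mult_mat_vec)
  also have "\<dots> = (\<Sum>i<d. \<Sum>j<k. (transpose_mat (slice d k j U) *\<^sub>v x) $ i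
      * row (slice d k j V) l $ i * y $ i)"
    unfolding sum_distrib_right
  proof (intro sum.cong refl)
    fix i j assume ij: "i \<in> {..<d}" "j \<in> {..<k}"
    then have p: "k * i + j < k * d"
      by (simp add: slice_index_less)
    have "(?D *\<^sub>v row V l) $ (k * i + j) = ?u $ (k * i + j) * row V l $ (k * i + j)"
      using p U V by (intro index_diag_mult_vec) auto
    moreover have "?u $ (k * i + j) = (transpose_mat (slice d k j U) *\<^sub>v x) $ i"
      using ij p U by (simp add: col_slice)
    moreover have "row V l $ (k * i + j) = row (slice d k j V) l $ i"
      using ij p V l by (simp add: index_slice[OF V])
    ultimately show "(?D *\<^sub>v row V l) $ (k * i + j) * y $ i
        = (transpose_mat (slice d k j U) *\<^sub>v x) $ i * row (slice d k j V) l $ i * y $ i"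
      by simp
  qed
  \<comment> \<open>Exchanging the sums puts the offset outside; each inner sum is then the diagonal
    form of one pair of slices.\<close>
  also have "\<dots> = (\<Sum>j<k. \<Sum>i<d. (transpose_mat (slice d k j U) *\<^sub>v x) $ i
      * row (slice d k j V) l $ i * y $ i)"
    by (rule sum.swap)
  also have "\<dots> = (\<Sum>j<k. (transpose_mat (slice d k j U) *\<^sub>v x)
      \<bullet> (diag_of_vec (row (slice d k j V) l) *\<^sub>v y))"
    using U V y
    by (intro sum.cong refl scalar_prod_diag[symmetric]) (auto intro!: carrier_vecI)
  finally show ?thesis .
qed

section \<open>RESCAL\<close>

text \<open>Every column of slice j of the repeated identity is the j-th unit vector, so slice j
  maps x to the constant vector with entry x_j. Its summand is x_j times the product of row l of
  slice j of V with y, which has to be row j of \<open>W l\<close> times y. This forces the entry of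
  V at (l, d * i + j) to be \<open>W l $$ (j, i)\<close>, whence the \<open>mod\<close> and
  \<open>div\<close> in V.\<close>

lemma lowfer_encodes_rescal:
  assumes W: "\<And>l. l < n \<Longrightarrow> W l \<in> carrier_mat d d"
  defines "V \<equiv> mat n (d * d) (\<lambda>(l, p). W l $$ (p mod d, p div d))"
  shows "V \<in> carrier_mat n (d * d)"
    and "l < n \<Longrightarrow> transpose_mat (reshape_rows d (row V l)) = W l"
    and "\<lbrakk>x \<in> carrier_vec d; y \<in> carrier_vec d; l < n\<rbrakk> \<Longrightarrow>
      lowfer_rel_score d d (1\<^sub>m n) (repeated_id_mat d d) V x l y = x \<bullet> (W l *\<^sub>v y)"
proof -
  show V: "V \<in> carrier_mat n (d * d)"
    by (simp add: V_def)
  have ent: "V $$ (l, d * i + j) = W l $$ (j, i)" if "l < n" "i < d" "j < d" for l i j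
    using that slice_index_less[of j d i d] by (simp add: V_def)
  \<comment> \<open>Reshaping puts position d * i + j at (i, j), where V stores the (j, i) entry of
    \<open>W l\<close>; the transpose undoes this swap.\<close>
  show "transpose_mat (reshape_rows d (row V l)) = W l" if l: "l < n"
    using W[OF l] V l slice_index_less[of _ d _ d] ent[OF l]
    by (intro eq_matI) (auto simp: reshape_rows_def mult.commute)
  show "lowfer_rel_score d d (1\<^sub>m n) (repeated_id_mat d d) V x l y = x \<bullet> (W l *\<^sub>v y)"
    if x: "x \<in> carrier_vec d" and y: "y \<in> carrier_vec d" and l: "l < n"
  proof -
    have U: "repeated_id_mat d d \<in> carrier_mat d (d * d)"
      by (simp add: repeated_id_mat_def)
    have Ux: "(transpose_mat (slice d d j (repeated_id_mat d d)) *\<^sub>v x) $ i = x $ j"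
      if "i < d" "j < d" for i j
    proof -
      \<comment> \<open>The column in question has index d * i + j, whose remainder modulo d is j
        since j < d.\<close>
      have "col (slice d d j (repeated_id_mat d d)) i = unit_vec d j"
        using that slice_index_less[of j d i d]
        by (intro eq_vecI) (auto simp: col_slice repeated_id_mat_def)
      then show ?thesis
        using that x by simp
    qed
    have "lowfer_rel_score d d (1\<^sub>m n) (repeated_id_mat d d) V x l y
        = (\<Sum>j<d. \<Sum>i<d. (transpose_mat (slice d d j (repeated_id_mat d d)) *\<^sub>v x) $ i
            * row (slice d d j V) l $ i * y $ i)"
      unfolding lowfer_rel_score_slices[OF U V x y l]
      using U V y
      by (intro sum.cong refl scalar_prod_diag) (auto intro!: carrier_vecI)
    \<comment> \<open>The factor x_j does not depend on i, so it leaves the inner sum, and what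
      remains is coordinate j of \<open>W l\<close> times y.\<close>
    also have "\<dots> = (\<Sum>j<d. x $ j * (\<Sum>i<d. W l $$ (j, i) * y $ i))"
    proof -
      have "row (slice d d j V) l $ i = W l $$ (j, i)" if "i < d" "j < d" for i j
        using that V l by (simp add: index_slice[OF V] ent)
      then show ?thesis
        by (auto simp: Ux sum_distrib_left mult.assoc simp del: index_mult_mat_vec index_row
            intro!: sum.cong)
    qed
    also have "\<dots> = x \<bullet> (W l *\<^sub>v y)"
      using W[OF l] x y by (simp add: scalar_prod_def lessThan_atLeast0)
    finally show ?thesis .
  qed
qed

section \<open>Factorization rank one: DistMult and SimplE\<close>

text \<open>For k = 1 there is a single residue class, so the slice sum has one term and its slices
  are U and V themselves.\<close>

lemma lowfer_rel_score_rank_1: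
  assumes U: "U \<in> carrier_mat d d" and V: "V \<in> carrier_mat n d"
    and x: "x \<in> carrier_vec d" and y: "y \<in> carrier_vec d" and l: "l < n"
  shows "lowfer_rel_score d 1 (1\<^sub>m n) U V x l y
    = (transpose_mat U *\<^sub>v x) \<bullet> (diag_of_vec (row V l) *\<^sub>v y)"
  using lowfer_rel_score_slices[of U d 1 V n x y l] assms
  by (simp add: slice_1[OF U, simplified] slice_1[OF V, simplified])

lemma lowfer_encodes_distmult:
  assumes "V \<in> carrier_mat n d" "x \<in> carrier_vec d" "y \<in> carrier_vec d" "l < n"
  shows "lowfer_rel_score d 1 (1\<^sub>m n) (1\<^sub>m d) V x l y = x \<bullet> (diag_of_vec (row V l) *\<^sub>v y)"
  using assms lowfer_rel_score_rank_1[of "1\<^sub>m d" d V n x y l] by simp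

text \<open>U exchanges the two halves of [h; t] and scales by 1/2, so h meets the second half [t']
  of the object and t the first half [h']. This is why the row of V lists the inverse relation
  vector r' before r.\<close>

lemma lowfer_encodes_simple:
  assumes V: "V \<in> carrier_mat n (2 * d)" and row_V: "row V l = r' @\<^sub>v r"
    and r: "r \<in> carrier_vec d" "r' \<in> carrier_vec d"
    and x: "h \<in> carrier_vec d" "t \<in> carrier_vec d"
    and y: "h' \<in> carrier_vec d" "t' \<in> carrier_vec d" and l: "l < n"
  shows "lowfer_rel_score (2 * d) 1 (1\<^sub>m n)
      (four_block_mat (0\<^sub>m d d) ((1/2) \<cdot>\<^sub>m 1\<^sub>m d) ((1/2) \<cdot>\<^sub>m 1\<^sub>m d) (0\<^sub>m d d))
      V (h @\<^sub>v t) l (h' @\<^sub>v t')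
    = 1/2 * (h \<bullet> (diag_of_vec r *\<^sub>v t') + h' \<bullet> (diag_of_vec r' *\<^sub>v t))"
proof -
  define H :: "real mat" where "H = (1/2) \<cdot>\<^sub>m 1\<^sub>m d"
  define U where "U = four_block_mat (0\<^sub>m d d) H H (0\<^sub>m d d)"
  have H: "H \<in> carrier_mat d d"
    by (simp add: H_def)
  have HT: "transpose_mat H = H"
    by (rule eq_matI) (auto simp: H_def)
  have Hv: "H *\<^sub>v v = (1/2) \<cdot>\<^sub>v v" if "v \<in> carrier_vec d" for v
    using that by (intro eq_vecI) (auto simp: H_def)
  have U: "U \<in> carrier_mat (2 * d) (2 * d)"
    using H by (auto simp: U_def mult_2)
  \<comment> \<open>Transposition exchanges the off-diagonal blocks, which are both the symmetric
    matrix H.\<close>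
  have "transpose_mat U = U"
    using transpose_four_block_mat[of "0\<^sub>m d d" d d H d H d "0\<^sub>m d d"] H
    by (simp add: U_def HT)
  then have "transpose_mat U *\<^sub>v (h @\<^sub>v t) = ((1/2) \<cdot>\<^sub>v t) @\<^sub>v ((1/2) \<cdot>\<^sub>v h)"
    using four_block_mat_mult_vec[of "0\<^sub>m d d" d d H d H d "0\<^sub>m d d" h t] H x
    by (simp add: U_def Hv zero_mult_vec)
  moreover have "h @\<^sub>v t \<in> carrier_vec (2 * d)" "h' @\<^sub>v t' \<in> carrier_vec (2 * d)"
    using x y by (auto simp: mult_2)
  ultimately have "lowfer_rel_score (2 * d) 1 (1\<^sub>m n) U V (h @\<^sub>v t) l (h' @\<^sub>v t')
      = (((1/2) \<cdot>\<^sub>v t) @\<^sub>v ((1/2) \<cdot>\<^sub>v h)) \<bullet> (diag_of_vec (r' @\<^sub>v r) *\<^sub>v (h' @\<^sub>v t'))"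
    using lowfer_rel_score_rank_1[OF U V _ _ l] row_V by simp
  also have "\<dots> = ((1/2) \<cdot>\<^sub>v t) \<bullet> (diag_of_vec r' *\<^sub>v h') + ((1/2) \<cdot>\<^sub>v h) \<bullet> (diag_of_vec r *\<^sub>v t')"
    using r x y by (intro scalar_prod_diag_append) auto
  also have "\<dots> = 1/2 * (t \<bullet> (diag_of_vec r' *\<^sub>v h')) + 1/2 * (h \<bullet> (diag_of_vec r *\<^sub>v t'))"
    using r x y by simp
  \<comment> \<open>The inverse term is turned around to the SimplE order, with the object's head
    vector first.\<close>
  also have "t \<bullet> (diag_of_vec r' *\<^sub>v h') = h' \<bullet> (diag_of_vec r' *\<^sub>v t)"
    using r x y by (intro scalar_prod_diag_commute) auto
  finally show ?thesis
    by (simp add: U_def H_def algebra_simps)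
qed

section \<open>ComplEx\<close>

text \<open>The transposed slices send [x; x'] to [x; x] and [- x'; x']. Pairing these with the rows
  [a; b] and [b; a] gives all four products, with the sign of the ComplEx score: coordinatewise, the
  real part of (x + i x')(a + i b)(y - i y').\<close>

lemma lowfer_encodes_complex:
  assumes U: "U \<in> carrier_mat (2 * d) (2 * (2 * d))"
    and U0: "slice (2 * d) 2 0 U = four_block_mat (1\<^sub>m d) (1\<^sub>m d) (0\<^sub>m d d) (0\<^sub>m d d)"
    and U1: "slice (2 * d) 2 1 U = four_block_mat (0\<^sub>m d d) (0\<^sub>m d d) (- 1\<^sub>m d) (1\<^sub>m d)"
    and V: "V \<in> carrier_mat n (2 * (2 * d))"
    and V0: "row (slice (2 * d) 2 0 V) l = a @\<^sub>v b"
    and V1: "row (slice (2 * d) 2 1 V) l = b @\<^sub>v a"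
    and r: "a \<in> carrier_vec d" "b \<in> carrier_vec d"
    and x: "x \<in> carrier_vec d" "x' \<in> carrier_vec d"
    and y: "y \<in> carrier_vec d" "y' \<in> carrier_vec d" and l: "l < n"
  shows "lowfer_rel_score (2 * d) 2 (1\<^sub>m n) U V (x @\<^sub>v x') l (y @\<^sub>v y')
    = x \<bullet> (diag_of_vec a *\<^sub>v y) + x' \<bullet> (diag_of_vec a *\<^sub>v y')
      + x \<bullet> (diag_of_vec b *\<^sub>v y') - x' \<bullet> (diag_of_vec b *\<^sub>v y)"
proof -
  have xx: "x @\<^sub>v x' \<in> carrier_vec (2 * d)" and yy: "y @\<^sub>v y' \<in> carrier_vec (2 * d)"
    using x y by (auto simp: mult_2)
  have m1: "- 1\<^sub>m d \<in> carrier_mat d d"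
    by simp
  have "transpose_mat (slice (2 * d) 2 0 U)
      = four_block_mat (1\<^sub>m d) (0\<^sub>m d d) (1\<^sub>m d) (0\<^sub>m d d)"
    unfolding U0 by (subst transpose_four_block_mat[of _ d d _ d _ d]) auto
  then have 0: "transpose_mat (slice (2 * d) 2 0 U) *\<^sub>v (x @\<^sub>v x') = x @\<^sub>v x"
    using x by (simp add: zero_mult_vec four_block_mat_mult_vec[of _ d d _ d _ d])
  have "transpose_mat (slice (2 * d) 2 1 U)
      = four_block_mat (0\<^sub>m d d) (- 1\<^sub>m d) (0\<^sub>m d d) (1\<^sub>m d)"
    unfolding U1 by (subst transpose_four_block_mat[of _ d d _ d _ d]) (auto simp: transpose_uminus)
  \<comment> \<open>The block \<open>- 1\<^sub>m d\<close> is the source of the only negative term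
    in the result.\<close>
  then have 1: "transpose_mat (slice (2 * d) 2 1 U) *\<^sub>v (x @\<^sub>v x') = (- x') @\<^sub>v x'"
    using x m1 by (simp add: zero_mult_vec four_block_mat_mult_vec[of _ d d _ d _ d])
  \<comment> \<open>With k = 2 the slice sum has exactly the two terms prepared above.\<close>
  have "lowfer_rel_score (2 * d) 2 (1\<^sub>m n) U V (x @\<^sub>v x') l (y @\<^sub>v y')
      = (x @\<^sub>v x) \<bullet> (diag_of_vec (a @\<^sub>v b) *\<^sub>v (y @\<^sub>v y'))
        + ((- x') @\<^sub>v x') \<bullet> (diag_of_vec (b @\<^sub>v a) *\<^sub>v (y @\<^sub>v y'))"
    unfolding lowfer_rel_score_slices[OF U V xx yy l]
    using 0 1 V0 V1 by (simp add: numeral_2_eq_2)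
  also have "\<dots> = (x \<bullet> (diag_of_vec a *\<^sub>v y) + x \<bullet> (diag_of_vec b *\<^sub>v y'))
      + ((- x') \<bullet> (diag_of_vec b *\<^sub>v y) + x' \<bullet> (diag_of_vec a *\<^sub>v y'))"
    using r x y by (simp add: scalar_prod_diag_append[of _ d _ _ _ d])
  also have "(- x') \<bullet> (diag_of_vec b *\<^sub>v y) = - (x' \<bullet> (diag_of_vec b *\<^sub>v y))"
    using r x y by simp
  finally show ?thesis
    by simp
qed

section \<open>The four encodings together\<close>

theorem mainTheorem3:
  fixes n\<^sub>r d\<^sub>e d :: nat
  assumes "1 \<le> n\<^sub>r"
  shows
    "(1 \<le> d\<^sub>e \<longrightarrow>
      (\<forall>W :: nat \<Rightarrow> real mat. (\<forall>l<n\<^sub>r. W l \<in> carrier_mat d\<^sub>e d\<^sub>e) \<longrightarrow>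
        (\<exists>V \<in> carrier_mat n\<^sub>r (d\<^sub>e * d\<^sub>e).
          (\<forall>l<n\<^sub>r. transpose_mat (reshape_rows d\<^sub>e (row V l)) = W l) \<and>
          (\<forall>e\<^sub>s \<in> carrier_vec d\<^sub>e. \<forall>e\<^sub>o \<in> carrier_vec d\<^sub>e. \<forall>l<n\<^sub>r.
            lowfer_rel_score d\<^sub>e d\<^sub>e (1\<^sub>m n\<^sub>r) (repeated_id_mat d\<^sub>e d\<^sub>e) V e\<^sub>s l e\<^sub>o
              = e\<^sub>s \<bullet> (W l *\<^sub>v e\<^sub>o)))))
    \<and>
     (\<forall>w :: nat \<Rightarrow> real vec. \<forall>V \<in> carrier_mat n\<^sub>r d\<^sub>e.
        (\<forall>l<n\<^sub>r. w l \<in> carrier_vec d\<^sub>e) \<longrightarrow> (\<forall>l<n\<^sub>r. row V l = w l) \<longrightarrow>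
        (\<forall>e\<^sub>s \<in> carrier_vec d\<^sub>e. \<forall>e\<^sub>o \<in> carrier_vec d\<^sub>e. \<forall>l<n\<^sub>r.
          lowfer_rel_score d\<^sub>e 1 (1\<^sub>m n\<^sub>r) (1\<^sub>m d\<^sub>e) V e\<^sub>s l e\<^sub>o
            = e\<^sub>s \<bullet> (diag_of_vec (w l) *\<^sub>v e\<^sub>o)))
    \<and>
     (\<forall>(r :: nat \<Rightarrow> real vec) (r_inv :: nat \<Rightarrow> real vec). \<forall>V \<in> carrier_mat n\<^sub>r (2 * d).
        (\<forall>l<n\<^sub>r. r l \<in> carrier_vec d \<and> r_inv l \<in> carrier_vec d) \<longrightarrow>
        (\<forall>l<n\<^sub>r. row V l = r_inv l @\<^sub>v r l) \<longrightarrow>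
        (\<forall>h\<^sub>s \<in> carrier_vec d. \<forall>t\<^sub>s \<in> carrier_vec d.
         \<forall>h\<^sub>o \<in> carrier_vec d. \<forall>t\<^sub>o \<in> carrier_vec d. \<forall>l<n\<^sub>r.
          lowfer_rel_score (2 * d) 1 (1\<^sub>m n\<^sub>r)
              (four_block_mat (0\<^sub>m d d) ((1/2) \<cdot>\<^sub>m 1\<^sub>m d) ((1/2) \<cdot>\<^sub>m 1\<^sub>m d) (0\<^sub>m d d))
              V (h\<^sub>s @\<^sub>v t\<^sub>s) l (h\<^sub>o @\<^sub>v t\<^sub>o)
            = 1/2 * (h\<^sub>s \<bullet> (diag_of_vec (r l) *\<^sub>v t\<^sub>o) + h\<^sub>o \<bullet> (diag_of_vec (r_inv l) *\<^sub>v t\<^sub>s))))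
    \<and>
     (\<forall>U \<in> carrier_mat (2 * d) (2 * (2 * d)).
        slice (2 * d) 2 0 U = four_block_mat (1\<^sub>m d) (1\<^sub>m d) (0\<^sub>m d d) (0\<^sub>m d d) \<longrightarrow>
        slice (2 * d) 2 1 U = four_block_mat (0\<^sub>m d d) (0\<^sub>m d d) (- 1\<^sub>m d) (1\<^sub>m d) \<longrightarrow>
        (\<forall>r :: nat \<Rightarrow> complex vec. \<forall>V \<in> carrier_mat n\<^sub>r (2 * (2 * d)).
          (\<forall>l<n\<^sub>r. r l \<in> carrier_vec d) \<longrightarrow>
          (\<forall>l<n\<^sub>r. row (slice (2 * d) 2 0 V) l = map_vec Re (r l) @\<^sub>v map_vec Im (r l)) \<longrightarrow>
          (\<forall>l<n\<^sub>r. row (slice (2 * d) 2 1 V) l = map_vec Im (r l) @\<^sub>v map_vec Re (r l)) \<longrightarrow>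
          (\<forall>e\<^sub>s \<in> carrier_vec d. \<forall>e\<^sub>o \<in> carrier_vec d. \<forall>l<n\<^sub>r.
            lowfer_rel_score (2 * d) 2 (1\<^sub>m n\<^sub>r) U V
                (map_vec Re e\<^sub>s @\<^sub>v map_vec Im e\<^sub>s) l (map_vec Re e\<^sub>o @\<^sub>v map_vec Im e\<^sub>o)
              = map_vec Re e\<^sub>s \<bullet> (diag_of_vec (map_vec Re (r l)) *\<^sub>v map_vec Re e\<^sub>o)
              + map_vec Im e\<^sub>s \<bullet> (diag_of_vec (map_vec Re (r l)) *\<^sub>v map_vec Im e\<^sub>o)
              + map_vec Re e\<^sub>s \<bullet> (diag_of_vec (map_vec Im (r l)) *\<^sub>v map_vec Im e\<^sub>o)
              - map_vec Im e\<^sub>s \<bullet> (diag_of_vec (map_vec Im (r l)) *\<^sub>v map_vec Re e\<^sub>o))))"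
proof (intro conjI)
  show "1 \<le> d\<^sub>e \<longrightarrow> (\<forall>W :: nat \<Rightarrow> real mat. (\<forall>l<n\<^sub>r. W l \<in> carrier_mat d\<^sub>e d\<^sub>e) \<longrightarrow>
        (\<exists>V \<in> carrier_mat n\<^sub>r (d\<^sub>e * d\<^sub>e).
          (\<forall>l<n\<^sub>r. transpose_mat (reshape_rows d\<^sub>e (row V l)) = W l) \<and>
          (\<forall>e\<^sub>s \<in> carrier_vec d\<^sub>e. \<forall>e\<^sub>o \<in> carrier_vec d\<^sub>e. \<forall>l<n\<^sub>r.
            lowfer_rel_score d\<^sub>e d\<^sub>e (1\<^sub>m n\<^sub>r) (repeated_id_mat d\<^sub>e d\<^sub>e) V e\<^sub>s l e\<^sub>o
              = e\<^sub>s \<bullet> (W l *\<^sub>v e\<^sub>o))))"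
    \<comment> \<open>The witness for V is the explicit matrix with entries
      \<open>W l $$ (p mod d, p div d)\<close>, taken at d = \<open>d\<^sub>e\<close>.\<close>
    using lowfer_encodes_rescal by (metis (no_types, lifting))
next
  show "\<forall>w :: nat \<Rightarrow> real vec. \<forall>V \<in> carrier_mat n\<^sub>r d\<^sub>e.
        (\<forall>l<n\<^sub>r. w l \<in> carrier_vec d\<^sub>e) \<longrightarrow> (\<forall>l<n\<^sub>r. row V l = w l) \<longrightarrow>
        (\<forall>e\<^sub>s \<in> carrier_vec d\<^sub>e. \<forall>e\<^sub>o \<in> carrier_vec d\<^sub>e. \<forall>l<n\<^sub>r.
          lowfer_rel_score d\<^sub>e 1 (1\<^sub>m n\<^sub>r) (1\<^sub>m d\<^sub>e) V e\<^sub>s l e\<^sub>o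
            = e\<^sub>s \<bullet> (diag_of_vec (w l) *\<^sub>v e\<^sub>o))"
    using lowfer_encodes_distmult by metis
next
  show "\<forall>(r :: nat \<Rightarrow> real vec) (r_inv :: nat \<Rightarrow> real vec). \<forall>V \<in> carrier_mat n\<^sub>r (2 * d).
        (\<forall>l<n\<^sub>r. r l \<in> carrier_vec d \<and> r_inv l \<in> carrier_vec d) \<longrightarrow>
        (\<forall>l<n\<^sub>r. row V l = r_inv l @\<^sub>v r l) \<longrightarrow>
        (\<forall>h\<^sub>s \<in> carrier_vec d. \<forall>t\<^sub>s \<in> carrier_vec d.
         \<forall>h\<^sub>o \<in> carrier_vec d. \<forall>t\<^sub>o \<in> carrier_vec d. \<forall>l<n\<^sub>r.
          lowfer_rel_score (2 * d) 1 (1\<^sub>m n\<^sub>r)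
              (four_block_mat (0\<^sub>m d d) ((1/2) \<cdot>\<^sub>m 1\<^sub>m d) ((1/2) \<cdot>\<^sub>m 1\<^sub>m d) (0\<^sub>m d d))
              V (h\<^sub>s @\<^sub>v t\<^sub>s) l (h\<^sub>o @\<^sub>v t\<^sub>o)
            = 1/2 * (h\<^sub>s \<bullet> (diag_of_vec (r l) *\<^sub>v t\<^sub>o) + h\<^sub>o \<bullet> (diag_of_vec (r_inv l) *\<^sub>v t\<^sub>s)))"
    by (intro allI ballI impI, rule lowfer_encodes_simple) auto
next
  show "\<forall>U \<in> carrier_mat (2 * d) (2 * (2 * d)).
        slice (2 * d) 2 0 U = four_block_mat (1\<^sub>m d) (1\<^sub>m d) (0\<^sub>m d d) (0\<^sub>m d d) \<longrightarrow>
        slice (2 * d) 2 1 U = four_block_mat (0\<^sub>m d d) (0\<^sub>m d d) (- 1\<^sub>m d) (1\<^sub>m d) \<longrightarrow>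
        (\<forall>r :: nat \<Rightarrow> complex vec. \<forall>V \<in> carrier_mat n\<^sub>r (2 * (2 * d)).
          (\<forall>l<n\<^sub>r. r l \<in> carrier_vec d) \<longrightarrow>
          (\<forall>l<n\<^sub>r. row (slice (2 * d) 2 0 V) l = map_vec Re (r l) @\<^sub>v map_vec Im (r l)) \<longrightarrow>
          (\<forall>l<n\<^sub>r. row (slice (2 * d) 2 1 V) l = map_vec Im (r l) @\<^sub>v map_vec Re (r l)) \<longrightarrow>
          (\<forall>e\<^sub>s \<in> carrier_vec d. \<forall>e\<^sub>o \<in> carrier_vec d. \<forall>l<n\<^sub>r.
            lowfer_rel_score (2 * d) 2 (1\<^sub>m n\<^sub>r) U V
                (map_vec Re e\<^sub>s @\<^sub>v map_vec Im e\<^sub>s) l (map_vec Re e\<^sub>o @\<^sub>v map_vec Im e\<^sub>o)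
              = map_vec Re e\<^sub>s \<bullet> (diag_of_vec (map_vec Re (r l)) *\<^sub>v map_vec Re e\<^sub>o)
              + map_vec Im e\<^sub>s \<bullet> (diag_of_vec (map_vec Re (r l)) *\<^sub>v map_vec Im e\<^sub>o)
              + map_vec Re e\<^sub>s \<bullet> (diag_of_vec (map_vec Im (r l)) *\<^sub>v map_vec Im e\<^sub>o)
              - map_vec Im e\<^sub>s \<bullet> (diag_of_vec (map_vec Im (r l)) *\<^sub>v map_vec Re e\<^sub>o)))"
    \<comment> \<open>The real and imaginary parts of the relation vector serve as a and b; those of
      the two entities serve as x, x' and y, y'.\<close>
    by (intro allI ballI impI, rule lowfer_encodes_complex) auto
qed

end
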